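(* Let $I=[a,b]\subset\mathbb{R}$, let $m$ be a nonnegative integer and let $P:I\to\mathbb{R}$ be an integrable function. If $$\int_a^b P(y)\frac{(b-y)^i}{i!}\,dy=0\quad\text{for all } i\in\{0,1,\ldots,m\}$$ and $$\int_a^s P(y)\frac{(s-y)^m}{m!}\,dy\ge 0\quad\text{for all } s\in[a,b],$$ then $$\int_a^b P(y)f(y)\,dy\ge 0$$ for every function $f\in C^{(m+1)}(I)$ that is completely monotonic of order $m+1$ on $I$.
   Context: Here $a<b$ and $(\cdot)^0=1$. A function $f:I\to\mathbb{R}$ is completely monotonic of order $r$ if its derivatives $f^{(i)}$ exist and satisfy $(-1)^i f^{(i)}(y)\ge 0$ on $I$ for all $i\in\{0,1,\ldots,r\}$. $C^{(m+1)}(I)$ denotes the functions with continuous derivatives up to order $m+1$ on $I$. *)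

theory Defs
  imports "HOL-Analysis.Analysis"
begin

text \<open>
  Derivatives are taken relative to the interval, i.e. one-sidedly at an end point of \<open>I\<close> that
  belongs to \<open>I\<close>. A function \<open>I \<Rightarrow> \<real>\<close> is represented by a total function, of which only the values
  on \<open>I\<close> are relevant. The function \<open>nth_deriv_on\<close> is total, so its values are meaningful only
  under \<open>times_differentiable_on\<close>.
\<close>

primrec nth_deriv_on :: "real set \<Rightarrow> nat \<Rightarrow> (real \<Rightarrow> real) \<Rightarrow> real \<Rightarrow> real" where
  "nth_deriv_on I 0 f = f"
| "nth_deriv_on I (Suc i) f = (\<lambda>x. vector_derivative (nth_deriv_on I i f) (at x within I))"

definition times_differentiable_on :: "nat \<Rightarrow> real set \<Rightarrow> (real \<Rightarrow> real) \<Rightarrow> bool" where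
  "times_differentiable_on r I f \<longleftrightarrow> (\<forall>i<r. nth_deriv_on I i f differentiable_on I)"

definition C_times_on :: "nat \<Rightarrow> real set \<Rightarrow> (real \<Rightarrow> real) \<Rightarrow> bool" where
  "C_times_on r I f \<longleftrightarrow>
     times_differentiable_on r I f \<and> (\<forall>i\<le>r. continuous_on I (nth_deriv_on I i f))"

definition completely_monotonic_on :: "nat \<Rightarrow> real set \<Rightarrow> (real \<Rightarrow> real) \<Rightarrow> bool" where
  "completely_monotonic_on r I f \<longleftrightarrow>
     times_differentiable_on r I f \<and> (\<forall>i\<le>r. \<forall>y\<in>I. (-1) ^ i * nth_deriv_on I i f y \<ge> 0)"

end

theory Submission
  imports Defs
begin

text \<open>
  Expand \<open>f\<close> around \<open>b\<close> by Taylor's formula with integral remainder. The moment conditions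
  annihilate the Taylor polynomial, and exchanging the order of integration in the remainder gives
  the integral over \<open>s\<close> of \<open>(-1)^(m+1) f^(m+1)(s)\<close> times the iterated integral of \<open>P\<close> up to \<open>s\<close>,
  a product of two nonnegative factors.
\<close>

lemma nth_deriv_on_has_vector_derivative:
  assumes "times_differentiable_on r I f" "i < r" "x \<in> I"
  shows "(nth_deriv_on I i f has_vector_derivative nth_deriv_on I (Suc i) f x) (at x within I)"
  using assms
  by (auto simp: times_differentiable_on_def differentiable_on_def vector_derivative_works)

text \<open>This is Taylor's formula about \<open>b\<close> with every sign moved onto the
  derivatives: (y - b)^i equals (-1)^i (b - y)^i, so all powers have nonnegative bases and the
  signed derivatives are the quantities controlled by complete monotonicity.\<close>

lemma taylor_at_right_endpoint:
  fixes f :: "real \<Rightarrow> real"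
  assumes diff: "times_differentiable_on (Suc m) {a..b} f" and y: "y \<in> {a..b}"
  shows "((\<lambda>s. (s - y) ^ m / fact m * ((-1) ^ Suc m * nth_deriv_on {a..b} (Suc m) f s)) has_integral
          f y - (\<Sum>i\<le>m. (b - y) ^ i / fact i * ((-1) ^ i * nth_deriv_on {a..b} i f b))) {y..b}"
proof -
  define D where "D i t = (-1) ^ i * nth_deriv_on {a..b} i f (- t)" for i t
  have D_deriv: "(D i has_vector_derivative D (Suc i) t) (at t within {-b..-y})"
    if i: "i < Suc m" and t: "-b \<le> t" "t \<le> -y" for i t
  proof -
    have "(nth_deriv_on {a..b} i f has_vector_derivative nth_deriv_on {a..b} (Suc i) f (- t))
            (at (- t) within {a..b})"
      using nth_deriv_on_has_vector_derivative[OF diff i] t y by auto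
    \<comment> \<open>The reflected interval is {y..b}, a subset of {a..b}, so the derivative
      relative to {a..b} restricts to it.\<close>
    then have "(nth_deriv_on {a..b} i f has_vector_derivative nth_deriv_on {a..b} (Suc i) f (- t))
            (at (- t) within uminus ` {-b..-y})"
      by (rule has_vector_derivative_within_subset) (use y in auto)
    moreover have "(uminus has_vector_derivative -1) (at t within {-b..-y})"
      by (auto intro!: derivative_eq_intros)
    ultimately have "(nth_deriv_on {a..b} i f \<circ> uminus has_vector_derivative
            (-1) *\<^sub>R nth_deriv_on {a..b} (Suc i) f (- t)) (at t within {-b..-y})"
      by (intro vector_diff_chain_within) auto
    from has_vector_derivative_mult_right[OF this, of "(-1) ^ i"]
    show ?thesis
      by (simp add: D_def[abs_def] o_def)
  qed
  have "((\<lambda>t. ((- y - t) ^ (Suc m - 1) / fact (Suc m - 1)) *\<^sub>R D (Suc m) t) has_integral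
          D 0 (- y) - (\<Sum>i<Suc m. ((- y - - b) ^ i / fact i) *\<^sub>R D i (- b))) {-b..-y}"
    by (rule Taylor_has_integral) (use D_deriv y in \<open>auto simp: D_def[abs_def]\<close>)
  then show ?thesis
    by (subst has_integral_reflect_real[symmetric])
       (simp add: D_def lessThan_Suc_atMost algebra_simps minus_diff_commute)
qed

text \<open>A countable Borel cover by sets of finite \<open>lborel\<close> measure also serves for
  the completion, where Borel sets keep their measure. Fubini requires this for the factor that
  carries \<open>P\<close>.\<close>

lemma sigma_finite_lebesgue: "sigma_finite_measure (lebesgue :: 'a::euclidean_space measure)"
proof (rule sigma_finite_measure.intro)
  obtain A :: "'a set set" where A: "countable A" "A \<subseteq> sets lborel" "\<Union>A = space lborel"
    "\<forall>a\<in>A. emeasure lborel a \<noteq> \<infinity>"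
    using lborel.sigma_finite_countable by blast
  then show "\<exists>A::'a set set. countable A \<and> A \<subseteq> sets lebesgue \<and> \<Union>A = space lebesgue \<and>
      (\<forall>a\<in>A. emeasure lebesgue a \<noteq> \<infinity>)"
    by (intro exI[of _ A]) (auto simp: subset_iff)
qed

text \<open>Tonelli: the inner integral of |p x * q y| is |p x| times the L1 norm of
  \<open>q\<close>, which is integrable in x. Such products serve as dominating functions.\<close>

lemma integrable_times_pair:
  fixes p :: "'a \<Rightarrow> real" and q :: "'b \<Rightarrow> real"
  assumes "pair_sigma_finite M N" and p: "integrable M p" and q: "integrable N q"
  shows "integrable (M \<Otimes>\<^sub>M N) (\<lambda>(x, y). p x * q y)"
proof -
  interpret pair_sigma_finite M N by fact
  have [measurable]: "p \<in> borel_measurable M" "q \<in> borel_measurable N"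
    using p q by auto
  show ?thesis
    by (rule Fubini_integrable) (use p q in \<open>auto simp: abs_mult intro!: AE_I2\<close>)
qed

text \<open>Fubini on the triangle a \<le> y \<le> s \<le> b. The y-factor is
  \<open>lebesgue\<close> because \<open>P\<close> is only Lebesgue measurable; the continuous
  \<open>g\<close> allows \<open>lborel\<close> for s. The second claim, also from Fubini, lets the
  remainder be split off later.\<close>

lemma integral_swap_triangle:
  fixes P g :: "real \<Rightarrow> real"
  assumes P: "set_integrable lebesgue {a..b} P" and g: "continuous_on {a..b} g"
  shows "(LINT y:{a..b}|lebesgue. P y * (LINT s:{y..b}|lborel. (s - y) ^ m / fact m * g s))
       = (LINT s:{a..b}|lborel. g s * (LINT y:{a..s}|lebesgue. P y * ((s - y) ^ m / fact m)))"
    and "set_integrable lebesgue {a..b} (\<lambda>y. P y * (LINT s:{y..b}|lborel. (s - y) ^ m / fact m * g s))"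
proof -
  define Q where "Q y = indicator {a..b} y * P y" for y
  define G where "G s = indicator {a..b} s * g s" for s
  \<comment> \<open>The cutoffs in \<open>Q\<close>, \<open>G\<close> and the conditional together
    confine \<open>k\<close> to the triangle, so both iterated integrals run over full
    spaces.\<close>
  define k where "k y s = Q y * G s * (if y \<le> s then (s - y) ^ m / fact m else 0)" for y s
  interpret pair_sigma_finite lebesgue lborel
    by (intro pair_sigma_finite.intro sigma_finite_lebesgue lborel.sigma_finite_measure_axioms)
  have Q: "integrable lebesgue Q"
    using P by (simp add: set_integrable_def Q_def[abs_def])
  have G: "integrable lborel G"
    using borel_integrable_atLeastAtMost'[OF g] by (simp add: set_integrable_def G_def[abs_def])
  have [measurable]: "Q \<in> borel_measurable lebesgue" "G \<in> borel_measurable lborel"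
    using Q G by auto
  \<comment> \<open>The first coordinate carries the larger Lebesgue sigma-algebra, so its
    projection is composed with the identity from Lebesgue to Borel sets.\<close>
  have [measurable]: "fst \<in> borel_measurable (lebesgue \<Otimes>\<^sub>M lborel)"
    by (rule measurable_compose[OF measurable_fst, of id, simplified])
       (auto intro!: measurable_completion)
  have k: "integrable (lebesgue \<Otimes>\<^sub>M lborel) (case_prod k)"
  proof (rule Bochner_Integration.integrable_bound)
    \<comment> \<open>On the triangle 0 \<le> s - y \<le> b - a, so replacing the kernel by its
      value at b - a gives a dominating function of product form.\<close>
    show "integrable (lebesgue \<Otimes>\<^sub>M lborel) (\<lambda>(y, s). Q y * (G s * ((b - a) ^ m / fact m)))"
      by (intro integrable_times_pair pair_sigma_finite_axioms Q integrable_mult_left G)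
    show "case_prod k \<in> borel_measurable (lebesgue \<Otimes>\<^sub>M lborel)"
      unfolding k_def case_prod_beta by measurable
    have "\<bar>k y s\<bar> \<le> \<bar>Q y * (G s * ((b - a) ^ m / fact m))\<bar>" for y s
    proof (cases "a \<le> y \<and> y \<le> s \<and> s \<le> b")
      case True
      then have "\<bar>(s - y) ^ m / fact m\<bar> \<le> \<bar>(b - a) ^ m / fact m\<bar>"
        by (auto simp: abs_mult power_abs intro!: divide_right_mono power_mono)
      then have "\<bar>Q y * G s\<bar> * \<bar>(s - y) ^ m / fact m\<bar> \<le> \<bar>Q y * G s\<bar> * \<bar>(b - a) ^ m / fact m\<bar>"
        by (rule mult_left_mono) simp
      then show ?thesis
        using True by (simp add: k_def abs_mult mult.assoc)
    next
      case False
      then have "k y s = 0"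
        by (auto simp: k_def Q_def G_def indicator_def)
      then show ?thesis by simp
    qed
    then show "AE z in lebesgue \<Otimes>\<^sub>M lborel.
        norm (case_prod k z) \<le> norm (case z of (y, s) \<Rightarrow> Q y * (G s * ((b - a) ^ m / fact m)))"
      by auto
  qed
  \<comment> \<open>For fixed y with \<open>Q y\<close> nonzero, a \<le> y holds, so the conditions
    y \<le> s and s \<in> {a..b} collapse to s \<in> {y..b}.\<close>
  have inner: "(LINT s|lborel. k y s)
      = indicator {a..b} y * (P y * (LINT s:{y..b}|lborel. (s - y) ^ m / fact m * g s))" for y
  proof -
    have "(LINT s|lborel. k y s)
        = (LINT s|lborel. Q y * (indicator {y..b} s * ((s - y) ^ m / fact m * g s)))"
      by (rule Bochner_Integration.integral_cong) (auto simp: k_def Q_def G_def indicator_def)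
    then show ?thesis
      by (simp add: set_lebesgue_integral_def Q_def)
  qed
  have outer: "(LINT y|lebesgue. k y s)
      = indicator {a..b} s * (g s * (LINT y:{a..s}|lebesgue. P y * ((s - y) ^ m / fact m)))" for s
  proof -
    have "(LINT y|lebesgue. k y s)
        = (LINT y|lebesgue. G s * (indicator {a..s} y * (P y * ((s - y) ^ m / fact m))))"
      by (rule Bochner_Integration.integral_cong) (auto simp: k_def Q_def G_def indicator_def)
    then show ?thesis
      by (simp add: set_lebesgue_integral_def G_def)
  qed
  show "(LINT y:{a..b}|lebesgue. P y * (LINT s:{y..b}|lborel. (s - y) ^ m / fact m * g s))
       = (LINT s:{a..b}|lborel. g s * (LINT y:{a..s}|lebesgue. P y * ((s - y) ^ m / fact m)))"
    using Fubini_integral[OF k] by (simp add: inner outer set_lebesgue_integral_def)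
  show "set_integrable lebesgue {a..b} (\<lambda>y. P y * (LINT s:{y..b}|lborel. (s - y) ^ m / fact m * g s))"
    using integrable_fst[OF k] by (simp add: inner set_integrable_def)
qed

text \<open>A continuous function on a compact interval is bounded and measurable, and such a factor
  preserves absolute integrability.\<close>

lemma set_integrable_mult_continuous:
  fixes P h :: "real \<Rightarrow> real"
  assumes P: "set_integrable lebesgue {a..b} P" and h: "continuous_on {a..b} h"
  shows "set_integrable lebesgue {a..b} (\<lambda>y. P y * h y)"
proof -
  have "bounded (h ` {a..b})"
    by (intro compact_imp_bounded compact_continuous_image h) auto
  moreover have "h \<in> borel_measurable (lebesgue_on {a..b})"
    by (rule continuous_imp_measurable_on_sets_lebesgue[OF h]) auto
  moreover have "P absolutely_integrable_on {a..b}"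
    by fact
  ultimately have "(\<lambda>y. h y * P y) absolutely_integrable_on {a..b}"
    by (intro absolutely_integrable_bounded_measurable_product_real) auto
  then show ?thesis
    by (simp add: mult.commute)
qed

theorem theorem2p5:
  fixes a b :: real and m :: nat and P :: "real \<Rightarrow> real"
  assumes "a < b"
    and "set_integrable lebesgue {a..b} P"
    and "\<And>i. i \<le> m \<Longrightarrow> (LINT y:{a..b}|lebesgue. P y * ((b - y) ^ i / fact i)) = 0"
    and "\<And>s. s \<in> {a..b} \<Longrightarrow> (LINT y:{a..s}|lebesgue. P y * ((s - y) ^ m / fact m)) \<ge> 0"
  shows "\<forall>f. C_times_on (m + 1) {a..b} f \<and> completely_monotonic_on (m + 1) {a..b} f \<longrightarrow>
           (LINT y:{a..b}|lebesgue. P y * f y) \<ge> 0"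
proof (intro allI impI)
  fix f
  assume f: "C_times_on (m + 1) {a..b} f \<and> completely_monotonic_on (m + 1) {a..b} f"
  define g where "g s = (-1) ^ Suc m * nth_deriv_on {a..b} (Suc m) f s" for s
  define c where "c i = (-1) ^ i * nth_deriv_on {a..b} i f b" for i
  define R where "R y = (LINT s:{y..b}|lborel. (s - y) ^ m / fact m * g s)" for y
  have diff: "times_differentiable_on (Suc m) {a..b} f"
    and cont: "continuous_on {a..b} (nth_deriv_on {a..b} (Suc m) f)"
    using f by (auto simp: C_times_on_def simp del: nth_deriv_on.simps)
  have g_nonneg: "g s \<ge> 0" if "s \<in> {a..b}" for s
    using f that by (auto simp: completely_monotonic_on_def g_def simp del: nth_deriv_on.simps)
  have g_cont: "continuous_on {a..b} g"
    unfolding g_def by (intro continuous_intros cont)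
  have taylor: "f y = (\<Sum>i\<le>m. (b - y) ^ i / fact i * c i) + R y" if y: "y \<in> {a..b}" for y
  proof -
    \<comment> \<open>Taylor's remainder is a gauge integral; continuity of the integrand identifies
      it with the Lebesgue integral used for Fubini.\<close>
    have "continuous_on {y..b} (\<lambda>s. (s - y) ^ m / fact m * g s)"
      by (intro continuous_intros continuous_on_subset[OF g_cont]) (use y in auto)
    then have "R y = integral {y..b} (\<lambda>s. (s - y) ^ m / fact m * g s)"
      unfolding R_def by (intro set_borel_integral_eq_integral borel_integrable_atLeastAtMost')
    also have "\<dots> = f y - (\<Sum>i\<le>m. (b - y) ^ i / fact i * c i)"
      using taylor_at_right_endpoint[OF diff y] unfolding g_def c_def by (rule integral_unique)
    finally show ?thesis by simp
  qed
  have moments: "set_integrable lebesgue {a..b} (\<lambda>y. P y * ((b - y) ^ i / fact i) * c i)" for i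
    by (intro set_integrable_mult_left impI set_integrable_mult_continuous assms continuous_intros) auto
  have "(LINT y:{a..b}|lebesgue. P y * f y)
      = (LINT y:{a..b}|lebesgue. (\<Sum>i\<le>m. P y * ((b - y) ^ i / fact i) * c i) + P y * R y)"
    by (rule set_lebesgue_integral_cong)
       (auto simp: taylor distrib_left sum_distrib_left mult.assoc)
  also have "\<dots> = (LINT y:{a..b}|lebesgue. (\<Sum>i\<le>m. P y * ((b - y) ^ i / fact i) * c i))
      + (LINT y:{a..b}|lebesgue. P y * R y)"
  \<comment> \<open>Additivity requires both parts to be integrable: the polynomial part by
    continuity of the powers, the remainder part by Fubini.\<close>
  proof (rule set_integral_add)
    show "set_integrable lebesgue {a..b} (\<lambda>y. \<Sum>i\<le>m. P y * ((b - y) ^ i / fact i) * c i)"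
      using moments unfolding set_integrable_def scaleR_sum_right
      by (intro Bochner_Integration.integrable_sum) auto
    show "set_integrable lebesgue {a..b} (\<lambda>y. P y * R y)"
      unfolding R_def by (rule integral_swap_triangle(2)[OF assms(2) g_cont])
  qed
  also have "(LINT y:{a..b}|lebesgue. (\<Sum>i\<le>m. P y * ((b - y) ^ i / fact i) * c i))
      = (\<Sum>i\<le>m. LINT y:{a..b}|lebesgue. P y * ((b - y) ^ i / fact i) * c i)"
    using moments unfolding set_lebesgue_integral_def set_integrable_def
    by (simp add: sum_distrib_left Bochner_Integration.integral_sum)
  \<comment> \<open>Each constant \<open>c i\<close> factors out, leaving the i-th moment, and the
    degrees 0 to m are exactly those covered by the moment conditions.\<close>
  also have "\<dots> = 0"
    using assms(3) by (intro sum.neutral) auto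
  also have "(LINT y:{a..b}|lebesgue. P y * R y)
      = (LINT s:{a..b}|lborel. g s * (LINT y:{a..s}|lebesgue. P y * ((s - y) ^ m / fact m)))"
    unfolding R_def by (rule integral_swap_triangle(1)[OF assms(2) g_cont])
  also have "0 + \<dots> \<ge> 0"
    unfolding add_0_left
  \<comment> \<open>Both factors are known to be nonnegative only for s in {a..b}; elsewhere the
    indicator makes the integrand zero.\<close>
  proof (subst set_lebesgue_integral_def, rule Bochner_Integration.integral_nonneg)
    fix s
    show "0 \<le> indicator {a..b} s *\<^sub>R
        (g s * (LINT y:{a..s}|lebesgue. P y * ((s - y) ^ m / fact m)))"
      using mult_nonneg_nonneg[OF g_nonneg[of s] assms(4)[of s]]
      by (cases "s \<in> {a..b}") simp_all
  qed
  finally show "(LINT y:{a..b}|lebesgue. P y * f y) \<ge> 0" .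
qed

end
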